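(* Let $G$ be a graph, let $v\in V(G)$, and set $G'=G\setminus\{v\}$. Let $\tau\in\mathrm{Taylor}(G)$. Then $\tau\in\mathrm{Scarf}(G)$ if and only if the following conditions are satisfied: (1) $\sigma=\tau|_{G'}\in\mathrm{Scarf}(G')$, and (2) $\tau=\sigma\cup\{vw_1,\dots,vw_t\}$, where $t\ge 0$ and $w_1,\dots,w_t\in N_G(v)$ are distinct, and either (a) $\mathrm{dist}_G(\sigma,vw_i)\ge 2$ for all $1\le i\le t$, and $w_iw_j\notin E(G)$ for all $1\le i<j\le t$; or (b) $\mathrm{dist}_G(\sigma,vw_1)=0$, $t=1$, $N_\sigma(w_1)\cap N_G(v)=\varnothing$, and $\mathrm{dist}_G(e,vw_1)\neq 1$ for all $e\in\sigma$.
   Context: Graphs are finite and simple; the vertices of $G$ are identified with variables of a polynomial ring over a field, and an edge $\{x,y\}$ with the monomial $xy$. $\mathrm{Taylor}(G)$ is the full simplex whose vertices are the edges of $G$ (the minimal generators of the edge ideal $I(G)=(xy\mid \{x,y\}\in E(G))$). Its faces are all subsets $\sigma\subseteq E(G)$, including $\varnothing$, and $\sigma$ is labeled by the monomial $\mathbf m_\sigma=\mathrm{lcm}(e: e\in\sigma)$ (with $\mathbf m_\varnothing=1$). $\mathrm{Scarf}(G)$ is the subcomplex of all faces of $\mathrm{Taylor}(G)$ whose label is not the label of any other face of $\mathrm{Taylor}(G)$. $G\setminus\{v\}$ is the induced subgraph of $G$ on $V(G)\setminus\{v\}$; $\tau|_{G'}$ is the set of edges in $\tau$ that are edges of $G'$.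 $N_G(v)=\{x\in V(G)\mid xv\in E(G)\}$, and for $\sigma\in\mathrm{Taylor}(G)$, $N_\sigma(w)=\{x\in V(G)\mid xw\in\sigma\}$. For edges $e,e'$ of $G$, $\mathrm{dist}_G(e,e')$ is the minimum number of edges of a path in $G$ connecting a vertex of $e$ to a vertex of $e'$ ($0$ if they share a vertex, $\infty$ if there is no such path); $\mathrm{dist}_G(\sigma,e')=\min\{\mathrm{dist}_G(e,e'): e\in\sigma\}$ (taken to be $\infty$ if $\sigma=\varnothing$). *)

theory Defs
  imports "HOL-Library.Multiset" "HOL-Library.Extended_Nat"
begin

record 'a graph =
  verts :: "'a set"
  edges :: "'a set set"

definition finite_simple_graph :: "'a graph \<Rightarrow> bool" where
  "finite_simple_graph G \<longleftrightarrow> finite (verts G) \<and> (\<forall>e \<in> edges G. e \<subseteq> verts G \<and> card e = 2)"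

definition induced_subgraph :: "'a graph \<Rightarrow> 'a set \<Rightarrow> 'a graph" where
  "induced_subgraph G W = \<lparr>verts = verts G \<inter> W, edges = {e \<in> edges G. e \<subseteq> W}\<rparr>"

definition delete_vertex :: "'a graph \<Rightarrow> 'a \<Rightarrow> 'a graph" where
  "delete_vertex G v = induced_subgraph G (verts G - {v})"

definition nbhd :: "'a graph \<Rightarrow> 'a \<Rightarrow> 'a set" where
  "nbhd G v = {x \<in> verts G. {x, v} \<in> edges G}"

definition face_nbhd :: "'a graph \<Rightarrow> 'a set set \<Rightarrow> 'a \<Rightarrow> 'a set" where
  "face_nbhd G \<sigma> w = {x \<in> verts G. {x, w} \<in> \<sigma>}"

definition face_restrict :: "'a set set \<Rightarrow> 'a graph \<Rightarrow> 'a set set" where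
  "face_restrict \<tau> H = {e \<in> \<tau>. e \<in> edges H}"

text \<open>
  A monomial in the variables \<open>verts G\<close> is represented by the multiset of its variables, so
  that divisibility of monomials is \<open>\<subseteq>#\<close>. The monomial of an edge \<open>{x, y}\<close> is
  \<open>mset_set {x, y} = {#x, y#}\<close>.
\<close>

definition edge_monomial :: "'a set \<Rightarrow> 'a multiset" where
  "edge_monomial e = mset_set e"

text \<open>
  \<open>Sup\<close> on multisets is the supremum for \<open>\<subseteq>#\<close>, i.e. the lcm of monomials
  (with \<open>Sup {} = {#}\<close>, the monomial 1); see \<open>face_label_is_lcm\<close> below.
\<close>

definition face_label :: "'a set set \<Rightarrow> 'a multiset" where
  "face_label \<sigma> = Sup (edge_monomial ` \<sigma>)"

lemma face_label_empty: "face_label {} = {#}"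
  by (simp add: face_label_def Sup_multiset_empty)

lemma face_label_is_lcm:
  assumes "finite \<sigma>"
  shows "face_label \<sigma> \<subseteq># M \<longleftrightarrow> (\<forall>e \<in> \<sigma>. edge_monomial e \<subseteq># M)"
proof (cases "\<sigma> = {}")
  case True
  then show ?thesis by (simp add: face_label_def Sup_multiset_empty)
next
  case False
  have "subset_mset.bdd_above (edge_monomial ` \<sigma>)"
    using assms by (intro subset_mset.bdd_above_finite) auto
  with False show ?thesis
    unfolding face_label_def by (subst subset_mset.cSup_le_iff) auto
qed

text \<open>Simplicial complexes are given by their sets of faces, the empty face included.\<close>

definition Taylor :: "'a graph \<Rightarrow> 'a set set set" where
  "Taylor G = Pow (edges G)"

definition Scarf :: "'a graph \<Rightarrow> 'a set set set" where
  "Scarf G = {\<sigma> \<in> Taylor G. \<forall>\<rho> \<in> Taylor G. \<rho> \<noteq> \<sigma> \<longrightarrow> face_label \<rho> \<noteq> face_label \<sigma>}"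

definition is_path :: "'a graph \<Rightarrow> 'a list \<Rightarrow> bool" where
  "is_path G p \<longleftrightarrow> p \<noteq> [] \<and> distinct p \<and> set p \<subseteq> verts G \<and>
     (\<forall>i. Suc i < length p \<longrightarrow> {p ! i, p ! Suc i} \<in> edges G)"

text \<open>
  The path \<open>p\<close> has \<open>length p - 1\<close> edges. In \<open>enat\<close> the infimum of the empty set is \<open>\<infinity>\<close>.
\<close>

definition edge_dist :: "'a graph \<Rightarrow> 'a set \<Rightarrow> 'a set \<Rightarrow> enat" where
  "edge_dist G e e' =
     Inf {enat (length p - 1) | p. is_path G p \<and> hd p \<in> e \<and> last p \<in> e'}"

definition face_dist :: "'a graph \<Rightarrow> 'a set set \<Rightarrow> 'a set \<Rightarrow> enat" where
  "face_dist G \<sigma> e' = (INF e \<in> \<sigma>. edge_dist G e e')"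

end

theory Submission
  imports Defs
begin

text \<open>
  Edge monomials are squarefree, so the label of a face \<open>\<tau>\<close> is the product of the vertices in
  \<open>\<Union>\<tau>\<close>, and two faces share a label exactly if they cover the same vertices. A face covers a vertex
  set that no other face covers if and only if no further edge of \<open>G\<close> lies inside \<open>\<Union>\<tau>\<close> and every
  edge of \<open>\<tau>\<close> has a private vertex, one that no other edge of \<open>\<tau>\<close> covers (lemma \<open>Scarf_iff\<close>).
  In other words, \<open>\<tau>\<close> is an induced subgraph of \<open>G\<close> each of whose components is a star. This
  property passes to the part \<open>\<sigma>\<close> of \<open>\<tau>\<close> that avoids \<open>v\<close> (lemma \<open>Scarf_delete_vertex\<close>).

  It remains to see how the edges \<open>{v, w}\<close> of \<open>\<tau>\<close> at \<open>v\<close> can be attached to \<open>\<sigma>\<close>. If none of the \<open>w\<close>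
  is covered by \<open>\<sigma>\<close>, then these edges form a star with centre \<open>v\<close> that is disjoint from \<open>\<sigma>\<close>, and
  inducedness says that no edge of \<open>G\<close> joins the star to \<open>\<sigma>\<close> or two of its leaves. This is the case
  of distance at least 2. If some \<open>w\<close> is covered by \<open>\<sigma>\<close>, then the private vertex of \<open>{v, w}\<close> can only
  be \<open>v\<close>, so \<open>{v, w}\<close> is the only edge at \<open>v\<close>: \<open>v\<close> is a new leaf, hung on the vertex \<open>w\<close> of \<open>\<sigma>\<close>.
  Inducedness then forbids every edge from \<open>v\<close> to another covered vertex \<open>x\<close>, which lies either in
  an edge \<open>{x, w}\<close> of \<open>\<sigma>\<close> or in an edge of \<open>\<sigma>\<close> at distance 1 from \<open>{v, w}\<close>. The edges of \<open>\<sigma>\<close> at \<open>w\<close>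
  can have their private vertex only at their other end, which again excludes edges at distance 1.
  Both cases are in lemma \<open>Scarf_star_cases\<close>, with the converses in \<open>Scarf_star_disjoint\<close> and
  \<open>Scarf_leaf_added\<close>.

  The distances matter only up to the value 1, where they just say whether two edges meet or are
  joined by an edge.
\<close>

section \<open>Small distances between edges\<close>

text \<open>
  An infimum of extended naturals is attained, except that of the empty family, which is \<open>\<infinity>\<close> and
  so not below any \<open>enat n\<close>.
\<close>

lemma enat_INF_le_iff:
  fixes f :: "'b \<Rightarrow> enat"
  shows "(INF a \<in> A. f a) \<le> enat n \<longleftrightarrow> (\<exists>a \<in> A. f a \<le> enat n)"
proof
  assume le: "(INF a \<in> A. f a) \<le> enat n"
  then have "f ` A \<noteq> {}"
    by (auto simp: top_enat_def)
  then have "(INF a \<in> A. f a) \<in> f ` A"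
    by (meson all_not_in_conv wellorder_InfI)
  with le show "\<exists>a \<in> A. f a \<le> enat n"
    by auto
qed (meson INF_lower2)

lemma edge_dist_le_iff:
  "edge_dist G e e' \<le> enat n \<longleftrightarrow>
    (\<exists>p. is_path G p \<and> hd p \<in> e \<and> last p \<in> e' \<and> length p - 1 \<le> n)"
proof -
  have "edge_dist G e e' = (INF p \<in> {p. is_path G p \<and> hd p \<in> e \<and> last p \<in> e'}. enat (length p - 1))"
    unfolding edge_dist_def by (rule arg_cong[where f = Inf]) auto
  then show ?thesis
    by (auto simp: enat_INF_le_iff)
qed

lemma edge_dist_eq_0_iff:
  assumes "e \<subseteq> verts G"
  shows "edge_dist G e e' = 0 \<longleftrightarrow> e \<inter> e' \<noteq> {}"
proof -
  have "edge_dist G e e' = 0 \<longleftrightarrow> edge_dist G e e' \<le> enat 0"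
    by (simp add: zero_enat_def[symmetric])
  also have "\<dots> \<longleftrightarrow> e \<inter> e' \<noteq> {}"
    unfolding edge_dist_le_iff
  proof
    assume "\<exists>p. is_path G p \<and> hd p \<in> e \<and> last p \<in> e' \<and> length p - 1 \<le> 0"
    then obtain p where p: "is_path G p" "hd p \<in> e" "last p \<in> e'" "length p \<le> 1"
      by auto
    from p(1,4) obtain x where "p = [x]"
      by (cases p) (auto simp: is_path_def)
    with p show "e \<inter> e' \<noteq> {}" by auto
  next
    assume "e \<inter> e' \<noteq> {}"
    then obtain x where "x \<in> e" "x \<in> e'" by auto
    with assms show "\<exists>p. is_path G p \<and> hd p \<in> e \<and> last p \<in> e' \<and> length p - 1 \<le> 0"
      by (intro exI[of _ "[x]"]) (auto simp: is_path_def)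
  qed
  finally show ?thesis .
qed

lemma edge_dist_le_1_iff:
  assumes "e \<subseteq> verts G" "e' \<subseteq> verts G"
  shows "edge_dist G e e' \<le> 1 \<longleftrightarrow> e \<inter> e' \<noteq> {} \<or> (\<exists>x \<in> e. \<exists>y \<in> e'. {x, y} \<in> edges G)"
proof -
  have "edge_dist G e e' \<le> 1 \<longleftrightarrow> edge_dist G e e' \<le> enat 1"
    by (simp add: one_enat_def)
  also have "\<dots> \<longleftrightarrow> e \<inter> e' \<noteq> {} \<or> (\<exists>x \<in> e. \<exists>y \<in> e'. {x, y} \<in> edges G)"
    unfolding edge_dist_le_iff
  proof
    assume "\<exists>p. is_path G p \<and> hd p \<in> e \<and> last p \<in> e' \<and> length p - 1 \<le> 1"
    then obtain p where p: "is_path G p" "hd p \<in> e" "last p \<in> e'" "length p \<le> 2"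
      by auto
    from p(1,4) consider x where "p = [x]" | x y where "p = [x, y]"
      by (cases p rule: remdups_adj.cases) (auto simp: is_path_def)
    then show "e \<inter> e' \<noteq> {} \<or> (\<exists>x \<in> e. \<exists>y \<in> e'. {x, y} \<in> edges G)"
      using p by cases (auto simp: is_path_def)
  next
    assume *: "e \<inter> e' \<noteq> {} \<or> (\<exists>x \<in> e. \<exists>y \<in> e'. {x, y} \<in> edges G)"
    show "\<exists>p. is_path G p \<and> hd p \<in> e \<and> last p \<in> e' \<and> length p - 1 \<le> 1"
    proof (cases "e \<inter> e' = {}")
      case False
      then obtain x where "x \<in> e" "x \<in> e'" by auto
      with assms show ?thesis
        by (intro exI[of _ "[x]"]) (auto simp: is_path_def)
    next
      case True
      with * obtain x y where "x \<in> e" "y \<in> e'" "{x, y} \<in> edges G" by auto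
      with assms True show ?thesis
        by (intro exI[of _ "[x, y]"]) (auto simp: is_path_def)
    qed
  qed
  finally show ?thesis .
qed

lemma enat_ge_2_iff: "(2::enat) \<le> x \<longleftrightarrow> \<not> x \<le> 1"
  by (cases x) (auto simp: one_enat_def numeral_eq_enat)

lemma edge_dist_eq_1_iff:
  assumes "e \<subseteq> verts G" "e' \<subseteq> verts G"
  shows "edge_dist G e e' = 1 \<longleftrightarrow> e \<inter> e' = {} \<and> (\<exists>x \<in> e. \<exists>y \<in> e'. {x, y} \<in> edges G)"
proof -
  have "edge_dist G e e' = 1 \<longleftrightarrow> edge_dist G e e' \<le> 1 \<and> edge_dist G e e' \<noteq> 0"
    by (cases "edge_dist G e e'") (auto simp: one_enat_def zero_enat_def)
  then show ?thesis
    using assms by (auto simp: edge_dist_le_1_iff edge_dist_eq_0_iff)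
qed

lemma face_dist_eq_0_iff:
  assumes "\<And>e. e \<in> \<sigma> \<Longrightarrow> e \<subseteq> verts G"
  shows "face_dist G \<sigma> e' = 0 \<longleftrightarrow> \<Union>\<sigma> \<inter> e' \<noteq> {}"
proof -
  have "face_dist G \<sigma> e' = 0 \<longleftrightarrow> (\<exists>e \<in> \<sigma>. edge_dist G e e' = 0)"
    using enat_INF_le_iff[of "\<lambda>e. edge_dist G e e'" \<sigma> 0]
    by (simp add: face_dist_def zero_enat_def[symmetric])
  then show ?thesis
    using assms by (auto simp: edge_dist_eq_0_iff)
qed

lemma face_dist_ge_2_iff:
  assumes "\<And>e. e \<in> \<sigma> \<Longrightarrow> e \<subseteq> verts G" "e' \<subseteq> verts G"
  shows "2 \<le> face_dist G \<sigma> e' \<longleftrightarrow>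
    \<Union>\<sigma> \<inter> e' = {} \<and> (\<forall>x \<in> \<Union>\<sigma>. \<forall>y \<in> e'. {x, y} \<notin> edges G)"
proof -
  have "2 \<le> face_dist G \<sigma> e' \<longleftrightarrow> (\<forall>e \<in> \<sigma>. \<not> edge_dist G e e' \<le> 1)"
    using enat_INF_le_iff[of "\<lambda>e. edge_dist G e e'" \<sigma> 1]
    by (simp add: enat_ge_2_iff face_dist_def one_enat_def)
  also have "\<dots> \<longleftrightarrow> (\<forall>e \<in> \<sigma>. e \<inter> e' = {} \<and> (\<forall>x \<in> e. \<forall>y \<in> e'. {x, y} \<notin> edges G))"
    using assms by (simp add: edge_dist_le_1_iff)
  finally show ?thesis by blast
qed

section \<open>Edges of a simple graph and of a vertex deletion\<close>

lemma finite_simple_graph_edgeD: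
  assumes "finite_simple_graph G" "e \<in> edges G"
  shows "e \<subseteq> verts G" "finite e" "card e = 2"
  using assms by (auto simp: finite_simple_graph_def intro: finite_subset)

lemma finite_simple_graph_finite_edges:
  assumes "finite_simple_graph G"
  shows "finite (edges G)"
  using assms by (auto simp: finite_simple_graph_def intro: finite_subset[of _ "Pow (verts G)"])

lemma finite_simple_graph_edge_through:
  assumes "finite_simple_graph G" "e \<in> edges G" "x \<in> e"
  obtains y where "e = {x, y}" "x \<noteq> y"
proof -
  from assms have "card e = 2" by (simp add: finite_simple_graph_def)
  then show thesis using assms(3) that by (auto simp: card_2_iff)
qed

lemma finite_simple_graph_delete_vertex:
  "finite_simple_graph G \<Longrightarrow> finite_simple_graph (delete_vertex G v)"
  by (auto simp: finite_simple_graph_def delete_vertex_def induced_subgraph_def)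

lemma edges_delete_vertex:
  assumes "finite_simple_graph G"
  shows "edges (delete_vertex G v) = {e \<in> edges G. v \<notin> e}"
  using finite_simple_graph_edgeD(1)[OF assms]
  by (auto simp: delete_vertex_def induced_subgraph_def)

section \<open>Scarf faces are the induced star forests\<close>

lemma face_label_eq_mset_set:
  assumes "finite \<sigma>" "\<And>e. e \<in> \<sigma> \<Longrightarrow> finite e"
  shows "face_label \<sigma> = mset_set (\<Union>\<sigma>)"
proof (rule subset_mset.antisym)
  have fin: "finite (\<Union>\<sigma>)" using assms by auto
  show "face_label \<sigma> \<subseteq># mset_set (\<Union>\<sigma>)"
    unfolding face_label_is_lcm[OF assms(1)] edge_monomial_def
    using fin by (auto intro!: subset_imp_msubset_mset_set)
  show "mset_set (\<Union>\<sigma>) \<subseteq># face_label \<sigma>"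
  proof (rule mset_subset_eqI)
    fix x
    show "count (mset_set (\<Union>\<sigma>)) x \<le> count (face_label \<sigma>) x"
    proof (cases "x \<in> \<Union>\<sigma>")
      case True
      then obtain e where e: "e \<in> \<sigma>" "x \<in> e" by auto
      then have "mset_set e \<subseteq># face_label \<sigma>"
        using face_label_is_lcm[OF assms(1), of "face_label \<sigma>"] by (auto simp: edge_monomial_def)
      then have "count (mset_set e) x \<le> count (face_label \<sigma>) x"
        by (rule mset_subset_eq_count)
      then show ?thesis using e True assms fin by auto
    qed auto
  qed
qed

text \<open>
  A second face with the label of \<open>\<tau>\<close> either has an edge outside \<open>\<tau>\<close>, and this edge lies inside
  \<open>\<Union>\<tau>\<close>, or omits an edge of \<open>\<tau>\<close>, both of whose vertices the rest of \<open>\<tau>\<close> must then cover. So it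
  suffices to exclude that a single edge can be added to or removed from \<open>\<tau>\<close> without changing the
  set of covered vertices.
\<close>

lemma Scarf_iff:
  assumes "finite_simple_graph G"
  shows "\<tau> \<in> Scarf G \<longleftrightarrow> \<tau> \<subseteq> edges G \<and>
    (\<forall>e \<in> edges G. e \<subseteq> \<Union>\<tau> \<longrightarrow> e \<in> \<tau>) \<and> (\<forall>e \<in> \<tau>. \<not> e \<subseteq> \<Union>(\<tau> - {e}))"
proof -
  have label_eq: "face_label \<rho> = face_label \<rho>' \<longleftrightarrow> \<Union>\<rho> = \<Union>\<rho>'"
    if "\<rho> \<subseteq> edges G" "\<rho>' \<subseteq> edges G" for \<rho> \<rho>'
  proof -
    have fin: "finite \<theta>" "\<And>e. e \<in> \<theta> \<Longrightarrow> finite e" if "\<theta> \<subseteq> edges G" for \<theta>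
      using that finite_simple_graph_edgeD(2)[OF assms] finite_simple_graph_finite_edges[OF assms]
      by (auto intro: finite_subset)
    show ?thesis
      using fin[OF that(1)] fin[OF that(2)]
      by (simp add: face_label_eq_mset_set)
  qed
  have "\<tau> \<in> Scarf G \<longleftrightarrow> \<tau> \<subseteq> edges G \<and> (\<forall>\<rho> \<subseteq> edges G. \<Union>\<rho> = \<Union>\<tau> \<longrightarrow> \<rho> = \<tau>)"
    unfolding Scarf_def Taylor_def mem_Collect_eq Pow_iff Ball_def
  proof (intro conj_cong refl all_cong1)
    fix \<rho> assume "\<tau> \<subseteq> edges G"
    then show "(\<rho> \<subseteq> edges G \<longrightarrow> \<rho> \<noteq> \<tau> \<longrightarrow> face_label \<rho> \<noteq> face_label \<tau>) \<longleftrightarrow>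
        (\<rho> \<subseteq> edges G \<longrightarrow> \<Union>\<rho> = \<Union>\<tau> \<longrightarrow> \<rho> = \<tau>)"
      using label_eq[of \<rho> \<tau>] by metis
  qed
  also have "\<dots> \<longleftrightarrow> \<tau> \<subseteq> edges G \<and>
    (\<forall>e \<in> edges G. e \<subseteq> \<Union>\<tau> \<longrightarrow> e \<in> \<tau>) \<and> (\<forall>e \<in> \<tau>. \<not> e \<subseteq> \<Union>(\<tau> - {e}))"
  proof (intro conj_cong refl iffI)
    assume sub: "\<tau> \<subseteq> edges G" and "\<forall>\<rho> \<subseteq> edges G. \<Union>\<rho> = \<Union>\<tau> \<longrightarrow> \<rho> = \<tau>"
    then have uniq: "\<rho> = \<tau>" if "\<rho> \<subseteq> edges G" "\<Union>\<rho> = \<Union>\<tau>" for \<rho>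
      using that by simp
    show "(\<forall>e \<in> edges G. e \<subseteq> \<Union>\<tau> \<longrightarrow> e \<in> \<tau>) \<and> (\<forall>e \<in> \<tau>. \<not> e \<subseteq> \<Union>(\<tau> - {e}))"
    proof (intro conjI ballI impI notI)
      fix e assume "e \<in> edges G" "e \<subseteq> \<Union>\<tau>"
      then have "insert e \<tau> \<subseteq> edges G" "\<Union>(insert e \<tau>) = \<Union>\<tau>"
        using sub by auto
      then have "insert e \<tau> = \<tau>"
        by (rule uniq)
      then show "e \<in> \<tau>" by auto
    next
      fix e assume "e \<in> \<tau>" "e \<subseteq> \<Union>(\<tau> - {e})"
      then have "\<tau> - {e} \<subseteq> edges G" "\<Union>(\<tau> - {e}) = \<Union>\<tau>"
        using sub by auto
      then have "\<tau> - {e} = \<tau>"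
        by (rule uniq)
      with \<open>e \<in> \<tau>\<close> show False by auto
    qed
  next
    assume sub: "\<tau> \<subseteq> edges G"
      and "(\<forall>e \<in> edges G. e \<subseteq> \<Union>\<tau> \<longrightarrow> e \<in> \<tau>) \<and> (\<forall>e \<in> \<tau>. \<not> e \<subseteq> \<Union>(\<tau> - {e}))"
    then have A: "\<And>e. e \<in> edges G \<Longrightarrow> e \<subseteq> \<Union>\<tau> \<Longrightarrow> e \<in> \<tau>"
      and B: "\<And>e. e \<in> \<tau> \<Longrightarrow> \<not> e \<subseteq> \<Union>(\<tau> - {e})" by auto
    show "\<forall>\<rho> \<subseteq> edges G. \<Union>\<rho> = \<Union>\<tau> \<longrightarrow> \<rho> = \<tau>"
    proof (intro allI impI)
      fix \<rho> assume \<rho>: "\<rho> \<subseteq> edges G" "\<Union>\<rho> = \<Union>\<tau>"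
      have le: "\<rho> \<subseteq> \<tau>"
        using \<rho> by (auto intro!: A)
      have "e \<in> \<rho>" if "e \<in> \<tau>" for e
      proof (rule ccontr)
        assume "e \<notin> \<rho>"
        then have "\<Union>\<rho> \<subseteq> \<Union>(\<tau> - {e})" using le by auto
        with \<rho>(2) that B[OF that] show False by auto
      qed
      with le show "\<rho> = \<tau>" by auto
    qed
  qed
  finally show ?thesis .
qed

section \<open>Attaching the edges at a vertex\<close>

text \<open>
  An edge that avoids \<open>v\<close> and is covered by the edges of \<open>\<tau>\<close> avoiding \<open>v\<close> is covered by \<open>\<tau>\<close>, and a
  private vertex stays private when other edges disappear.
\<close>

lemma Scarf_delete_vertex:
  assumes G: "finite_simple_graph G" and "\<tau> \<in> Scarf G"
  shows "{e \<in> \<tau>. v \<notin> e} \<in> Scarf (delete_vertex G v)"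
proof -
  have \<tau>E: "\<tau> \<subseteq> edges G"
    and A: "\<And>e. e \<in> edges G \<Longrightarrow> e \<subseteq> \<Union>\<tau> \<Longrightarrow> e \<in> \<tau>"
    and B: "\<And>e. e \<in> \<tau> \<Longrightarrow> \<not> e \<subseteq> \<Union>(\<tau> - {e})"
    using assms(2) unfolding Scarf_iff[OF G] by blast+
  show ?thesis
    unfolding Scarf_iff[OF finite_simple_graph_delete_vertex[OF G]] edges_delete_vertex[OF G]
  proof (intro conjI ballI impI)
    show "{e \<in> \<tau>. v \<notin> e} \<subseteq> {e \<in> edges G. v \<notin> e}" using \<tau>E by blast
  next
    fix e assume "e \<in> {e \<in> edges G. v \<notin> e}" "e \<subseteq> \<Union>{e \<in> \<tau>. v \<notin> e}"
    then show "e \<in> {e \<in> \<tau>. v \<notin> e}" using A[of e] by blast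
  next
    fix e assume "e \<in> {e \<in> \<tau>. v \<notin> e}"
    then show "\<not> e \<subseteq> \<Union>({e \<in> \<tau>. v \<notin> e} - {e})" using B[of e] by blast
  qed
qed

text \<open>
  Distance at least 2 keeps the star at \<open>v\<close> and \<open>\<sigma>\<close> disjoint and unjoined. Hence the private vertices
  of \<open>\<sigma>\<close> stay private, and each edge \<open>{v, w}\<close> has the leaf \<open>w\<close> as its private vertex.
\<close>

lemma Scarf_star_disjoint:
  assumes G: "finite_simple_graph G"
    and vG: "v \<in> verts G"
    and \<sigma>: "\<sigma> \<in> Scarf (delete_vertex G v)"
    and W: "W \<subseteq> nbhd G v"
    and far: "\<And>w. w \<in> W \<Longrightarrow> 2 \<le> face_dist G \<sigma> {v, w}"
    and indep: "\<And>w w'. w \<in> W \<Longrightarrow> w' \<in> W \<Longrightarrow> {w, w'} \<notin> edges G"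
  shows "\<sigma> \<union> (\<lambda>w. {v, w}) ` W \<in> Scarf G"
proof -
  let ?\<tau> = "\<sigma> \<union> (\<lambda>w. {v, w}) ` W"
  have \<sigma>E: "\<sigma> \<subseteq> edges G" and v\<sigma>: "v \<notin> \<Union>\<sigma>"
    and A: "\<And>e. e \<in> edges G \<Longrightarrow> v \<notin> e \<Longrightarrow> e \<subseteq> \<Union>\<sigma> \<Longrightarrow> e \<in> \<sigma>"
    and B: "\<And>e. e \<in> \<sigma> \<Longrightarrow> \<not> e \<subseteq> \<Union>(\<sigma> - {e})"
    using \<sigma> unfolding Scarf_iff[OF finite_simple_graph_delete_vertex[OF G]]
      edges_delete_vertex[OF G] by blast+
  note v = vG v\<sigma>
  have WE: "w \<in> verts G" "{v, w} \<in> edges G" "w \<noteq> v" if "w \<in> W" for w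
    using that W finite_simple_graph_edgeD(3)[OF G, of "{w, v}"]
    by (auto simp: nbhd_def insert_commute)
  have \<sigma>V: "\<And>e. e \<in> \<sigma> \<Longrightarrow> e \<subseteq> verts G"
    using finite_simple_graph_edgeD(1)[OF G] \<sigma>E by blast
  have far': "w \<notin> \<Union>\<sigma>" "\<And>x. x \<in> \<Union>\<sigma> \<Longrightarrow> {x, v} \<notin> edges G \<and> {x, w} \<notin> edges G"
    if "w \<in> W" for w
  proof -
    have "\<Union>\<sigma> \<inter> {v, w} = {} \<and> (\<forall>x \<in> \<Union>\<sigma>. \<forall>y \<in> {v, w}. {x, y} \<notin> edges G)"
      using far[OF that] v(1) WE(1)[OF that] \<sigma>V by (subst (asm) face_dist_ge_2_iff) auto
    then show "w \<notin> \<Union>\<sigma>" "\<And>x. x \<in> \<Union>\<sigma> \<Longrightarrow> {x, v} \<notin> edges G \<and> {x, w} \<notin> edges G"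
      by blast+
  qed
  show ?thesis
    unfolding Scarf_iff[OF G]
  proof (intro conjI ballI impI)
    show "?\<tau> \<subseteq> edges G" using \<sigma>E WE by auto
  next
    fix e assume e: "e \<in> edges G" "e \<subseteq> \<Union>?\<tau>"
    obtain x y where xy: "e = {x, y}" "x \<noteq> y"
      using finite_simple_graph_edgeD(3)[OF G e(1)] by (auto simp: card_2_iff)
    have mem: "z \<in> \<Union>\<sigma> \<or> z = v \<and> W \<noteq> {} \<or> z \<in> W" if "z \<in> e" for z
      using e(2) that by blast
    (* Otherwise this edge of G would join \<sigma> to the star, at distance 1 from {v, w} for some w. *)
    have propagate: "z \<in> \<Union>\<sigma>" if z: "e = {z', z}" "z' \<in> \<Union>\<sigma>" for z z'
    proof (rule ccontr)
      assume "z \<notin> \<Union>\<sigma>"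
      then obtain w where w: "w \<in> W" "z = v \<or> z = w" using mem[of z] z(1) by blast
      with far'(2)[OF w(1) z(2)] e(1) z(1) show False by blast
    qed
    show "e \<in> ?\<tau>"
    proof (cases "x \<in> \<Union>\<sigma> \<or> y \<in> \<Union>\<sigma>")
      case True
      then have "x \<in> \<Union>\<sigma> \<and> y \<in> \<Union>\<sigma>"
        using propagate[of x y] propagate[of y x] xy(1) by (metis insert_commute)
      then have "e \<subseteq> \<Union>\<sigma>" using xy(1) by blast
      then show ?thesis using A[OF e(1)] v(2) by auto
    next
      case False
      then have "(x = v \<or> x \<in> W) \<and> (y = v \<or> y \<in> W)"
        using mem xy by auto
      then show ?thesis using indep e(1) xy by (auto simp: insert_commute)
    qed
  next
    fix e assume "e \<in> ?\<tau>"
    then consider "e \<in> \<sigma>" | w where "w \<in> W" "e = {v, w}" by auto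
    then show "\<not> e \<subseteq> \<Union>(?\<tau> - {e})"
    proof cases
      case 1
      then obtain x where "x \<in> e" "x \<notin> \<Union>(\<sigma> - {e})" using B by blast
      moreover have "x \<noteq> v" "x \<notin> W" using 1 \<open>x \<in> e\<close> far' v(2) by blast+
      ultimately show ?thesis by auto
    next
      case 2
      then have "w \<notin> \<Union>(?\<tau> - {e})" using far'(1) WE(3) by auto
      with 2 show ?thesis by auto
    qed
  qed
qed

text \<open>
  The new edge \<open>{v, w}\<close> has \<open>v\<close> as its private vertex. An edge of \<open>\<sigma>\<close> could lose its private vertex
  only if that vertex is \<open>w\<close>; then its other end \<open>y\<close> is private as well, because a further edge of
  \<open>\<sigma>\<close> through \<open>y\<close> would be joined to \<open>w\<close> by \<open>{w, y}\<close>, hence at distance 1.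
\<close>

lemma Scarf_leaf_added:
  assumes G: "finite_simple_graph G"
    and vG: "v \<in> verts G"
    and \<sigma>: "\<sigma> \<in> Scarf (delete_vertex G v)"
    and w: "w \<in> nbhd G v"
    and meets: "face_dist G \<sigma> {v, w} = 0"
    and no_triangle: "face_nbhd G \<sigma> w \<inter> nbhd G v = {}"
    and no_dist_1: "\<And>e. e \<in> \<sigma> \<Longrightarrow> edge_dist G e {v, w} \<noteq> 1"
  shows "insert {v, w} \<sigma> \<in> Scarf G"
proof -
  let ?\<tau> = "insert {v, w} \<sigma>"
  have \<sigma>E: "\<sigma> \<subseteq> edges G" and v\<sigma>: "v \<notin> \<Union>\<sigma>"
    and A: "\<And>e. e \<in> edges G \<Longrightarrow> v \<notin> e \<Longrightarrow> e \<subseteq> \<Union>\<sigma> \<Longrightarrow> e \<in> \<sigma>"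
    and B: "\<And>e. e \<in> \<sigma> \<Longrightarrow> \<not> e \<subseteq> \<Union>(\<sigma> - {e})"
    using \<sigma> unfolding Scarf_iff[OF finite_simple_graph_delete_vertex[OF G]]
      edges_delete_vertex[OF G] by blast+
  note v = vG v\<sigma>
  have wE: "w \<in> verts G" "{v, w} \<in> edges G" "w \<noteq> v"
    using w finite_simple_graph_edgeD(3)[OF G, of "{w, v}"]
    by (auto simp: nbhd_def insert_commute)
  have \<sigma>V: "\<And>e. e \<in> \<sigma> \<Longrightarrow> e \<subseteq> verts G"
    using finite_simple_graph_edgeD(1)[OF G] \<sigma>E by blast
  have w\<sigma>: "w \<in> \<Union>\<sigma>"
    using meets v(2) \<sigma>V by (simp add: face_dist_eq_0_iff)
  (* Edges of \<sigma> that are joined to {v, w} must meet it, and they can only do so in w. *)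
  have joined: "w \<in> e" if "e \<in> \<sigma>" "x \<in> e" "{x, v} \<in> edges G \<or> {x, w} \<in> edges G" for e x
    using no_dist_1[OF that(1)] that \<sigma>V v wE by (auto simp: edge_dist_eq_1_iff)
  show ?thesis
    unfolding Scarf_iff[OF G]
  proof (intro conjI ballI impI)
    show "?\<tau> \<subseteq> edges G" using \<sigma>E wE by auto
  next
    fix e assume e: "e \<in> edges G" "e \<subseteq> \<Union>?\<tau>"
    show "e \<in> ?\<tau>"
    proof (cases "v \<in> e")
      case False
      then have "e \<subseteq> \<Union>\<sigma>" using e(2) w\<sigma> by auto
      with A e(1) False show ?thesis by auto
    next
      case True
      then obtain x where x: "e = {v, x}" "v \<noteq> x"
        by (rule finite_simple_graph_edge_through[OF G e(1)])
      have "x = w"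
      proof (rule ccontr)
        assume "x \<noteq> w"
        then obtain f where f: "f \<in> \<sigma>" "x \<in> f" using e(2) x by auto
        then have "w \<in> f" using joined[OF f] e(1) x by (auto simp: insert_commute)
        from f(1) \<sigma>E have "f \<in> edges G" by blast
        then obtain y where "f = {x, y}"
          using f(2) by (rule finite_simple_graph_edge_through[OF G])
        with \<open>w \<in> f\<close> \<open>x \<noteq> w\<close> have "f = {x, w}" by auto
        then have "x \<in> face_nbhd G \<sigma> w \<inter> nbhd G v"
          using f \<sigma>V e(1) x by (auto simp: face_nbhd_def nbhd_def insert_commute)
        with no_triangle show False by auto
      qed
      with x show ?thesis by auto
    qed
  next
    fix e assume "e \<in> ?\<tau>"
    then consider "e = {v, w}" | "e \<in> \<sigma>" by auto
    then show "\<not> e \<subseteq> \<Union>(?\<tau> - {e})"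
    proof cases
      case 1
      then show ?thesis using v(2) by auto
    next
      case 2
      then obtain x where x: "x \<in> e" "x \<notin> \<Union>(\<sigma> - {e})" using B by blast
      obtain y where y: "e = {x, y}" "x \<noteq> y"
        using finite_simple_graph_edge_through[OF G _ x(1)] 2 \<sigma>E by blast
      have ne: "x \<noteq> v" "y \<noteq> v" using 2 v(2) y by auto
      show ?thesis
      proof (cases "x = w")
        case False
        with x ne show ?thesis by auto
      next
        case True
        have "y \<notin> \<Union>(\<sigma> - {e})"
        proof
          assume "y \<in> \<Union>(\<sigma> - {e})"
          then obtain f where f: "f \<in> \<sigma>" "f \<noteq> e" "y \<in> f" by auto
          then have "w \<in> f"
            using joined[OF f(1,3)] 2 \<sigma>E y True by (auto simp: insert_commute)
          with x f True show False by auto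
        qed
        with y ne True show ?thesis by auto
      qed
    qed
  qed
qed

text \<open>
  The two cases are told apart by whether \<open>\<sigma>\<close> covers one of the neighbours of \<open>v\<close> in \<open>\<tau>\<close>. In both
  cases, an edge of \<open>G\<close> that violates the claim has its two ends covered by \<open>\<tau>\<close>, so it belongs to
  \<open>\<tau>\<close>, and there it makes \<open>\<sigma>\<close> cover a vertex that it should not cover, gives \<open>v\<close> a second
  neighbour, or is an edge without a private vertex.
\<close>

lemma Scarf_star_cases:
  assumes G: "finite_simple_graph G"
    and v: "v \<in> verts G" "v \<notin> \<Union>\<sigma>"
    and \<tau>: "\<tau> = \<sigma> \<union> (\<lambda>w. {v, w}) ` W" "\<tau> \<in> Scarf G"
  shows "(\<forall>w \<in> W. 2 \<le> face_dist G \<sigma> {v, w}) \<and> (\<forall>w \<in> W. \<forall>w' \<in> W. {w, w'} \<notin> edges G) \<or>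
    (\<exists>w. W = {w} \<and> face_dist G \<sigma> {v, w} = 0 \<and> face_nbhd G \<sigma> w \<inter> nbhd G v = {} \<and>
      (\<forall>e \<in> \<sigma>. edge_dist G e {v, w} \<noteq> 1))"
proof -
  have \<tau>E: "\<tau> \<subseteq> edges G"
    and A: "\<And>e. e \<in> edges G \<Longrightarrow> e \<subseteq> \<Union>\<tau> \<Longrightarrow> e \<in> \<tau>"
    and B: "\<And>e. e \<in> \<tau> \<Longrightarrow> \<not> e \<subseteq> \<Union>(\<tau> - {e})"
    using \<tau>(2) unfolding Scarf_iff[OF G] by blast+
  have \<tau>V: "\<And>e. e \<in> \<tau> \<Longrightarrow> e \<subseteq> verts G"
    using finite_simple_graph_edgeD(1)[OF G] \<tau>E by blast
  have \<sigma>V: "\<And>e. e \<in> \<sigma> \<Longrightarrow> e \<subseteq> verts G" using \<tau>V \<tau>(1) by blast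
  have W: "w \<noteq> v" "w \<in> verts G" "{v, w} \<in> \<tau>" if "w \<in> W" for w
  proof -
    show "{v, w} \<in> \<tau>" using \<tau>(1) that by auto
    then show "w \<in> verts G" using \<tau>V by auto
    show "w \<noteq> v" using finite_simple_graph_edgeD(3)[OF G, of "{v, w}"] \<tau>E \<open>{v, w} \<in> \<tau>\<close> by auto
  qed
  have at_v: "x \<in> W" if "{x, v} \<in> \<tau>" for x
    using that v(2) \<tau>(1) by (auto simp: doubleton_eq_iff)
  have A': "{x, y} \<in> \<tau>" if "{x, y} \<in> edges G" "x \<in> \<Union>\<tau>" "y \<in> \<Union>\<tau>" for x y
    using A[OF that(1)] that(2,3) by blast
  have sub: "\<Union>\<sigma> \<subseteq> \<Union>\<tau>" using \<tau>(1) by blast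
  have cover: "v \<in> \<Union>\<tau>" "w \<in> \<Union>\<tau>" if "w \<in> W" for w
    using W(3)[OF that] by blast+
  have off_v: "e \<in> \<sigma>" if "e \<in> \<tau>" "v \<notin> e" for e
    using that \<tau>(1) by auto
  show ?thesis
  proof (cases "\<exists>w \<in> W. w \<in> \<Union>\<sigma>")
    case True
    then obtain w where w: "w \<in> W" "w \<in> \<Union>\<sigma>" by auto
    then obtain f where f: "f \<in> \<sigma>" "w \<in> f" by auto
    have fv: "f \<noteq> {v, w}" using f v(2) by auto
    (* w lies on f as well, and v would lie on a second edge: {v, w} would have no private vertex. *)
    have single: "w' = w" if "w' \<in> W" for w'
    proof (rule ccontr)
      assume "w' \<noteq> w"
      then have "{v, w'} \<in> \<tau> - {{v, w}}" using W[OF that] by (auto simp: doubleton_eq_iff)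
      moreover have "f \<in> \<tau> - {{v, w}}" using f fv \<tau>(1) by auto
      ultimately have "{v, w} \<subseteq> \<Union>(\<tau> - {{v, w}})" using f(2) by blast
      with B[OF W(3)[OF w(1)]] show False by blast
    qed
    have "W = {w}" using w single by blast
    moreover have "face_dist G \<sigma> {v, w} = 0"
      using w \<sigma>V by (auto simp: face_dist_eq_0_iff)
    moreover have "face_nbhd G \<sigma> w \<inter> nbhd G v = {}"
    proof -
      have False if x: "{x, w} \<in> \<sigma>" "{x, v} \<in> edges G" for x
      proof -
        have "{x, v} \<in> \<tau>" using A'[OF x(2)] x(1) sub cover(1)[OF w(1)] by blast
        then have "x = w" using at_v[of x] single[of x] by blast
        moreover have "card {x, w} = 2"
          using x(1) \<tau>(1) \<tau>E finite_simple_graph_edgeD(3)[OF G, of "{x, w}"] by blast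
        ultimately show False by simp
      qed
      then show ?thesis by (auto simp: face_nbhd_def nbhd_def)
    qed
    moreover have "edge_dist G e {v, w} \<noteq> 1" if e: "e \<in> \<sigma>" for e
    proof
      assume "edge_dist G e {v, w} = 1"
      then obtain x y where xy: "w \<notin> e" "v \<notin> e" "x \<in> e" "y = v \<or> y = w" "{x, y} \<in> edges G"
        using e \<sigma>V v W[OF w(1)] by (auto simp: edge_dist_eq_1_iff)
      have "x \<in> \<Union>\<tau>" "y \<in> \<Union>\<tau>" using xy(3,4) e sub cover[OF w(1)] by blast+
      then have xy\<tau>: "{x, y} \<in> \<tau>" using A'[OF xy(5)] by blast
      from xy(4) show False
      proof
        assume "y = v"
        with xy\<tau> at_v[of x] single[of x] xy(1,3) show False by blast
      next
        assume y: "y = w"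
        (* Neither end of {x, w} is private: x lies on e, and w on {v, w}. *)
        have "v \<notin> {x, y}" using xy(2,3) y W(1)[OF w(1)] by blast
        then have "e \<in> \<tau> - {{x, y}}" "{v, w} \<in> \<tau> - {{x, y}}"
          using e xy(1) y W(3)[OF w(1)] \<tau>(1) by blast+
        then have "{x, y} \<subseteq> \<Union>(\<tau> - {{x, y}})" using xy(3) y by blast
        with B[OF xy\<tau>] show False by blast
      qed
    qed
    ultimately show ?thesis by blast
  next
    case False
    have "2 \<le> face_dist G \<sigma> {v, w}" if w: "w \<in> W" for w
    proof -
      have "\<Union>\<sigma> \<inter> {v, w} = {}" using v(2) w False by auto
      moreover have "{x, y} \<notin> edges G" if "x \<in> \<Union>\<sigma>" "y \<in> {v, w}" for x y
      proof
        assume "{x, y} \<in> edges G"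
        then have "{x, y} \<in> \<tau>" using A'[of x y] that sub cover[OF w] by blast
        moreover have "x \<notin> W" "x \<noteq> v" using that(1) False v(2) by auto
        ultimately have "y = w" "{x, y} \<in> \<sigma>"
          using at_v[of x] off_v[of "{x, y}"] that(2) W[OF w] by auto
        with w False show False by auto
      qed
      ultimately show ?thesis
        using \<sigma>V v(1) W(2)[OF w] by (subst face_dist_ge_2_iff) auto
    qed
    moreover have "{w, w'} \<notin> edges G" if "w \<in> W" "w' \<in> W" for w w'
    proof
      assume "{w, w'} \<in> edges G"
      then have "{w, w'} \<in> \<tau>" using A'[of w w'] that cover(2) by blast
      then have "{w, w'} \<in> \<sigma>" using W that by (intro off_v) auto
      with that False show False by auto
    qed
    ultimately show ?thesis by blast
  qed
qed

section \<open>Scarf faces of a graph and of a vertex deletion\<close>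

theorem theorem5p7:
  fixes G G' :: "'a graph" and v :: 'a and \<sigma> \<tau> :: "'a set set"
  assumes "finite_simple_graph G"
    and "v \<in> verts G"
    and "G' = delete_vertex G v"
    and "\<tau> \<in> Taylor G"
    and "\<sigma> = face_restrict \<tau> G'"
  shows "\<tau> \<in> Scarf G \<longleftrightarrow>
    \<sigma> \<in> Scarf G' \<and>
    (\<exists>(t::nat) (w::nat \<Rightarrow> 'a).
       (\<forall>i \<in> {1..t}. w i \<in> nbhd G v) \<and>
       inj_on w {1..t} \<and>
       \<tau> = \<sigma> \<union> {{v, w i} | i. i \<in> {1..t}} \<and>
       (((\<forall>i \<in> {1..t}. face_dist G \<sigma> {v, w i} \<ge> 2) \<and>
         (\<forall>i j. 1 \<le> i \<and> i < j \<and> j \<le> t \<longrightarrow> {w i, w j} \<notin> edges G))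
        \<or>
        (face_dist G \<sigma> {v, w 1} = 0 \<and>
         t = 1 \<and>
         face_nbhd G \<sigma> (w 1) \<inter> nbhd G v = {} \<and>
         (\<forall>e \<in> \<sigma>. edge_dist G e {v, w 1} \<noteq> 1))))"
    (is "_ \<longleftrightarrow> _ \<and> (\<exists>t w. ?P t w)")
proof -
  note G = assms(1)
  have \<tau>E: "\<tau> \<subseteq> edges G" using assms(4) by (simp add: Taylor_def)
  have \<sigma>_eq: "\<sigma> = {e \<in> \<tau>. v \<notin> e}"
    using \<tau>E by (auto simp: assms(3,5) face_restrict_def edges_delete_vertex[OF G])
  have v\<sigma>: "v \<notin> \<Union>\<sigma>" by (auto simp: \<sigma>_eq)
  have star: "{{v, w i} | i. i \<in> {1..t}} = (\<lambda>x. {v, x}) ` (w ` {1..t})" for w and t :: nat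
    by auto
  show ?thesis
  proof
    assume \<tau>: "\<tau> \<in> Scarf G"
    have "\<sigma> \<in> Scarf G'"
      using Scarf_delete_vertex[OF G \<tau>] by (simp add: assms(3) \<sigma>_eq)
    moreover have "\<exists>t w. ?P t w"
    proof -
      define W where "W = {w. {v, w} \<in> \<tau>}"
      have W_nbhd: "W \<subseteq> nbhd G v"
        using \<tau>E finite_simple_graph_edgeD(1)[OF G, of "{v, w}" for w]
        by (auto simp: W_def nbhd_def insert_commute)
      then have "finite W"
        using G by (auto simp: nbhd_def finite_simple_graph_def intro: finite_subset)
      then obtain w where w: "bij_betw w {1..card W} W"
        using ex_bij_betw_nat_finite_1 by blast
      then have img: "w ` {1..card W} = W" and inj: "inj_on w {1..card W}"
        by (auto simp: bij_betw_def)
      have \<tau>_eq: "\<tau> = \<sigma> \<union> (\<lambda>x. {v, x}) ` W"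
        using \<tau>E by (auto simp: \<sigma>_eq W_def elim!: finite_simple_graph_edge_through[OF G, rotated])
      have "?P (card W) w"
        unfolding star img
      proof (intro conjI)
        show "\<forall>i \<in> {1..card W}. w i \<in> nbhd G v" using img W_nbhd by auto
        show "inj_on w {1..card W}" by fact
        show "\<tau> = \<sigma> \<union> (\<lambda>x. {v, x}) ` W" by fact
        show "((\<forall>i \<in> {1..card W}. face_dist G \<sigma> {v, w i} \<ge> 2) \<and>
            (\<forall>i j. 1 \<le> i \<and> i < j \<and> j \<le> card W \<longrightarrow> {w i, w j} \<notin> edges G)) \<or>
          (face_dist G \<sigma> {v, w 1} = 0 \<and> card W = 1 \<and>
            face_nbhd G \<sigma> (w 1) \<inter> nbhd G v = {} \<and> (\<forall>e \<in> \<sigma>. edge_dist G e {v, w 1} \<noteq> 1))"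
          using Scarf_star_cases[OF G assms(2) v\<sigma> \<tau>_eq \<tau>]
        proof (elim disjE conjE exE)
          assume "\<forall>w \<in> W. 2 \<le> face_dist G \<sigma> {v, w}" "\<forall>w \<in> W. \<forall>w' \<in> W. {w, w'} \<notin> edges G"
          moreover have "w i \<in> W" if "1 \<le> i" "i \<le> card W" for i using img that by auto
          ultimately show ?thesis by auto
        next
          fix u assume u: "W = {u}"
            and "face_dist G \<sigma> {v, u} = 0" "face_nbhd G \<sigma> u \<inter> nbhd G v = {}"
              "\<forall>e \<in> \<sigma>. edge_dist G e {v, u} \<noteq> 1"
          moreover have "w 1 = u" using img u by auto
          ultimately show ?thesis by auto
        qed
      qed
      then show ?thesis by blast
    qed
    ultimately show "\<sigma> \<in> Scarf G' \<and> (\<exists>t w. ?P t w)" ..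
  next
    assume "\<sigma> \<in> Scarf G' \<and> (\<exists>t w. ?P t w)"
    then obtain t w where \<sigma>: "\<sigma> \<in> Scarf (delete_vertex G v)" and P: "?P t w"
      using assms(3) by blast
    let ?W = "w ` {1..t}"
    have W: "?W \<subseteq> nbhd G v" and \<tau>_eq: "\<tau> = \<sigma> \<union> (\<lambda>x. {v, x}) ` ?W"
      using P unfolding star by auto
    from P consider
      (disjoint) "\<forall>i \<in> {1..t}. face_dist G \<sigma> {v, w i} \<ge> 2"
        "\<forall>i j. 1 \<le> i \<and> i < j \<and> j \<le> t \<longrightarrow> {w i, w j} \<notin> edges G"
      | (leaf) "face_dist G \<sigma> {v, w 1} = 0" "t = 1" "face_nbhd G \<sigma> (w 1) \<inter> nbhd G v = {}"
        "\<forall>e \<in> \<sigma>. edge_dist G e {v, w 1} \<noteq> 1"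
      by blast
    then show "\<tau> \<in> Scarf G"
    proof cases
      case disjoint
      have "{x, y} \<notin> edges G" if xy: "x \<in> ?W" "y \<in> ?W" for x y
      proof -
        obtain i j where ij: "x = w i" "y = w j" "i \<in> {1..t}" "j \<in> {1..t}" using xy by auto
        show ?thesis
        proof (cases i j rule: linorder_cases)
          case less
          then show ?thesis using ij disjoint(2) by auto
        next
          case equal
          then show ?thesis using ij finite_simple_graph_edgeD(3)[OF G, of "{x, y}"] by auto
        next
          case greater
          then show ?thesis using ij disjoint(2)[rule_format, of j i] by (simp add: insert_commute)
        qed
      qed
      then show ?thesis
        unfolding \<tau>_eq
        using disjoint(1) by (intro Scarf_star_disjoint[OF G assms(2) \<sigma> W]) auto
    next
      case leaf
      have "insert {v, w 1} \<sigma> \<in> Scarf G"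
        using leaf W by (intro Scarf_leaf_added[OF G assms(2) \<sigma>]) auto
      with leaf(2) show ?thesis by (simp add: \<tau>_eq)
    qed
  qed
qed

end
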